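(* Let $n\ge1$, $0<\alpha<2$, and let $G\in C^1(\mathbb{R})$ satisfy $G(0)=0$ and $G'(t)\ge c_0>0$ for all $t\in\mathbb{R}$. Let $\lambda\in\mathbb{R}$, $\Sigma=\{x\in\mathbb{R}^n: x_1<\lambda\}$, let $\Omega\subset\Sigma$ be an unbounded region, and let $c:\Omega\to\mathbb{R}$ satisfy $$\liminf_{|x|\to\infty}|x|^\alpha c(x)\ge 0 .$$ Then there exists a constant $R_0>0$ (depending on $c(x)$, but independent of $w$) with the following property. If $u:\mathbb{R}^n\to\mathbb{R}$, $u_\lambda(x)=u(x^\lambda)$ and $w=u_\lambda-u$ are such that $w\in L_\alpha\cap C^{1,1}_{loc}(\Omega)$ and $$\begin{cases}F_\alpha(u_\lambda(x))-F_\alpha(u(x))+c(x)w(x)\ge 0 & \text{in }\Omega,\\ w(x)\ge 0 & \text{in }\Sigma\setminus\Omega,\\ w(x^\lambda)=-w(x) & \text{in }\Sigma,\end{cases}$$ and if $x^0\in\Omega$ satisfies $w(x^0)=\min_\Omega w<0$, then $|x^0|\le R_0$.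
   Context: For $x=(x_1,\dots,x_n)\in\mathbb{R}^n$, $x^\lambda=(2\lambda-x_1,x_2,\dots,x_n)$ is the reflection of $x$ about the plane $T_\lambda=\{x_1=\lambda\}$. For $0<\alpha<2$, $$F_\alpha(u(x)) = C_{n,\alpha}\lim_{\epsilon\to0}\int_{\mathbb{R}^n\setminus B_\epsilon(x)}\frac{G(u(x)-u(z))}{|x-z|^{n+\alpha}}\,dz,$$ where $C_{n,\alpha}>0$ is a constant depending only on $n$ and $\alpha$. It is understood that $u\in L_\alpha$ and that $F_\alpha(u(x))$ and $F_\alpha(u_\lambda(x))$ are well defined (the integrals converge for every $\epsilon>0$ and the limits exist and are finite) for $x\in\Omega$. The space $L_\alpha$ is $$L_\alpha=\Big\{u\in L^1_{loc}(\mathbb{R}^n)\ :\ \int_{\mathbb{R}^n}\frac{|u(x)|}{1+|x|^{n+\alpha}}\,dx<\infty\Big\}.$$ Functions are real-valued and defined at every point of $\mathbb{R}^n$. A region is an open set; the limit inferior is taken over $x\in\Omega$. *)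

theory Defs
  imports "HOL-Analysis.Analysis"
begin

text \<open>
  The space \<open>\<real>\<^sup>n\<close> is \<open>real ^ 'n\<close> with \<open>n = CARD('n)\<close>. A finite index type has no canonical
  first element, so the coordinate called \<open>x\<^sub>1\<close> is \<open>x $ i\<close> for an arbitrary index \<open>i\<close>.
\<close>

definition reflect :: "'n \<Rightarrow> real \<Rightarrow> real ^ 'n \<Rightarrow> real ^ 'n" where
  "reflect i lam x = (\<chi> j. if j = i then 2 * lam - x $ i else x $ j)"

definition halfspace :: "'n \<Rightarrow> real \<Rightarrow> (real ^ 'n) set" where
  "halfspace i lam = {x. x $ i < lam}"

text \<open>
  Local integrability makes \<open>u\<close> Lebesgue measurable, so integrability of the weighted
  function is finiteness of the integral of \<open>\<bar>u x\<bar> / (1 + \<bar>x\<bar>\<^sup>n\<^sup>+\<^sup>\<alpha>)\<close>.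
\<close>

definition L_space :: "real \<Rightarrow> (real ^ 'n \<Rightarrow> real) set" where
  "L_space \<alpha> = {u. (\<forall>K. compact K \<longrightarrow> set_integrable lebesgue K u) \<and>
     integrable lebesgue (\<lambda>x. \<bar>u x\<bar> / (1 + norm x powr (real CARD('n) + \<alpha>)))}"

text \<open>\<open>g\<close> is the gradient of \<open>w\<close>; its continuity follows from the Lipschitz condition.\<close>

definition C11_loc :: "(real ^ 'n) set \<Rightarrow> (real ^ 'n \<Rightarrow> real) set" where
  "C11_loc \<Omega> = {w. \<exists>g. (\<forall>x\<in>\<Omega>. (w has_derivative (\<lambda>h. g x \<bullet> h)) (at x)) \<and>
     (\<forall>K. compact K \<and> K \<subseteq> \<Omega> \<longrightarrow> (\<exists>L. L-lipschitz_on K g))}"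

definition F_integrand ::
    "(real \<Rightarrow> real) \<Rightarrow> real \<Rightarrow> (real ^ 'n \<Rightarrow> real) \<Rightarrow> real ^ 'n \<Rightarrow> real ^ 'n \<Rightarrow> real" where
  "F_integrand G \<alpha> u x z = G (u x - u z) / norm (x - z) powr (real CARD('n) + \<alpha>)"

definition F_truncated ::
    "(real \<Rightarrow> real) \<Rightarrow> real \<Rightarrow> (real ^ 'n \<Rightarrow> real) \<Rightarrow> real ^ 'n \<Rightarrow> real \<Rightarrow> real" where
  "F_truncated G \<alpha> u x \<epsilon> = (LINT z:(- ball x \<epsilon>)|lebesgue. F_integrand G \<alpha> u x z)"

text \<open>\<open>C\<close> is the normalising constant \<open>C\<^sub>n\<^sub>,\<^sub>\<alpha>\<close>; only its positivity is ever assumed.\<close>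

definition F_op ::
    "real \<Rightarrow> (real \<Rightarrow> real) \<Rightarrow> real \<Rightarrow> (real ^ 'n \<Rightarrow> real) \<Rightarrow> real ^ 'n \<Rightarrow> real" where
  "F_op C G \<alpha> u x = C * Lim (at_right 0) (F_truncated G \<alpha> u x)"

text \<open>
  Without this predicate \<open>F_op\<close> may take a meaningless default value: a non-integrable
  function has integral \<open>0\<close>, and \<open>Lim\<close> is unspecified if there is no limit.
\<close>

definition F_well_defined ::
    "(real \<Rightarrow> real) \<Rightarrow> real \<Rightarrow> (real ^ 'n \<Rightarrow> real) \<Rightarrow> real ^ 'n \<Rightarrow> bool" where
  "F_well_defined G \<alpha> u x \<longleftrightarrow>
     (\<forall>\<epsilon>>0. set_integrable lebesgue (- ball x \<epsilon>) (F_integrand G \<alpha> u x)) \<and>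
     (\<exists>l. (F_truncated G \<alpha> u x \<longlongrightarrow> l) (at_right 0))"

end

theory Submission
  imports Defs
begin

text \<open>
  At a negative minimum \<open>x\<close> of \<open>w\<close> over \<open>\<Sigma>\<close>, pair the contributions of \<open>z \<in> \<Sigma>\<close> and \<open>z\<^sup>\<lambda>\<close> to
  \<open>F\<^sub>\<alpha>(u\<^sub>\<lambda>(x)) - F\<^sub>\<alpha>(u(x))\<close>. They are \<open>a / \<bar>x - z\<bar>\<^sup>n\<^sup>+\<^sup>\<alpha>\<close> and \<open>b / \<bar>x - z\<^sup>\<lambda>\<bar>\<^sup>n\<^sup>+\<^sup>\<alpha>\<close>, where \<open>a \<le> 0\<close> by
  minimality and \<open>a + b \<le> 2 c\<^sub>0 w(x)\<close> because \<open>G\<close> has slope at least \<open>c\<^sub>0\<close>. Since \<open>z\<close> is closer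
  to \<open>x\<close> than \<open>z\<^sup>\<lambda>\<close>, the pair is at most \<open>2 c\<^sub>0 w(x) / \<bar>x - z\<^sup>\<lambda>\<bar>\<^sup>n\<^sup>+\<^sup>\<alpha>\<close>. Integrating over a ball
  beyond \<open>T\<^sub>\<lambda>\<close> of radius comparable to \<open>\<bar>x\<bar>\<close> bounds the difference by \<open>\<kappa> w(x) / \<bar>x\<bar>\<^sup>\<alpha>\<close> with
  \<open>\<kappa> > 0\<close> depending only on the data, so the differential inequality forces
  \<open>\<bar>x\<bar>\<^sup>\<alpha> c(x) \<le> -\<kappa>\<close>, which fails for large \<open>\<bar>x\<bar>\<close>.
\<close>

section \<open>Reflection about the plane and Lebesgue measure\<close>

lemma reflect_reflect [simp]: "reflect i lam (reflect i lam x) = x"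
  by (simp add: reflect_def vec_eq_iff)

lemma reflect_nth: "reflect i lam x $ j = (if j = i then 2 * lam - x $ i else x $ j)"
  by (simp add: reflect_def)

text \<open>The diagonal affine form to which the change of variables
  \<open>lebesgue_affine_euclidean\<close> applies. All scaling factors are 1 or -1, so the density
  there is 1 and reflection preserves the measure.\<close>

lemma reflect_eq_affine:
  fixes i :: "'n::finite"
  shows "reflect i lam = (\<lambda>x. (2 * lam) *\<^sub>R axis i 1 +
    (\<Sum>j\<in>Basis. ((if j = axis i 1 then -1 else 1) * (x \<bullet> j)) *\<^sub>R j))"
proof (rule ext, rule euclidean_eqI)
  fix x b :: "real ^ 'n"
  assume b: "b \<in> Basis"
  then obtain k where k: "b = axis k 1"
    by (auto simp: Basis_vec_def)
  show "reflect i lam x \<bullet> b = ((2 * lam) *\<^sub>R axis i 1 +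
      (\<Sum>j\<in>Basis. ((if j = axis i 1 then -1 else 1) * (x \<bullet> j)) *\<^sub>R j)) \<bullet> b"
    unfolding inner_add_left inner_sum_left_Basis[OF b] unfolding k
    by (auto simp: inner_axis_axis inner_axis reflect_nth axis_eq_axis) (simp add: axis_def)
qed

lemma reflect_measurable: "reflect i lam \<in> lebesgue \<rightarrow>\<^sub>M lebesgue"
  unfolding reflect_eq_affine by (rule lebesgue_affine_measurable) auto

lemma distr_lebesgue_reflect:
  fixes i :: "'n::finite"
  shows "distr lebesgue lebesgue (reflect i lam) = lebesgue"
proof -
  have "(\<Prod>j\<in>(Basis :: (real ^ 'n) set). \<bar>if j = axis i 1 then -1 else 1::real\<bar>) = 1"
    by (rule prod.neutral) auto
  then show ?thesis
    using lebesgue_affine_euclidean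
      [of "\<lambda>j. if j = axis i 1 then -1 else 1" "(2 * lam) *\<^sub>R axis i 1 :: real ^ 'n"]
    unfolding reflect_eq_affine by (simp add: density_1)
qed

lemma integrable_reflect_lebesgue:
  fixes f :: "real ^ 'n::finite \<Rightarrow> real"
  assumes "integrable lebesgue f"
  shows "integrable lebesgue (\<lambda>z. f (reflect i lam z))"
  using integrable_distr[OF reflect_measurable[of i lam], of f] assms
  by (simp add: distr_lebesgue_reflect)

lemma integral_reflect_lebesgue:
  fixes f :: "real ^ 'n::finite \<Rightarrow> real"
  assumes "integrable lebesgue f"
  shows "(\<integral>z. f (reflect i lam z) \<partial>lebesgue) = integral\<^sup>L lebesgue f"
  using integral_distr[OF reflect_measurable[of i lam], of f] assms
  by (simp add: distr_lebesgue_reflect borel_measurable_integrable)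

section \<open>Pointwise estimate for a pair of mirror points\<close>

lemma norm_diff_le_norm_diff_reflect:
  fixes x z :: "real ^ 'n::finite"
  assumes "x $ i \<le> lam" "z $ i \<le> lam"
  shows "norm (x - z) \<le> norm (x - reflect i lam z)"
  by (rule norm_le_componentwise_cart) (use assms in \<open>auto simp: reflect_nth\<close>)

lemma deriv_ge_imp_diff_ge:
  fixes G :: "real \<Rightarrow> real"
  assumes "G C1_differentiable_on UNIV" "\<And>t. deriv G t \<ge> c0" "s \<le> t"
  shows "c0 * (t - s) \<le> G t - G s"
proof -
  have "(G has_real_derivative deriv G y) (at y)" for y
    using assms(1) by (simp add: C1_differentiable_on_eq DERIV_deriv_iff_real_differentiable)
  then have "((\<lambda>y. G y - c0 * y) has_real_derivative deriv G y - c0) (at y)" for y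
    by (auto intro!: derivative_eq_intros)
  moreover have "0 \<le> deriv G y - c0" for y
    using assms(2)[of y] by simp
  ultimately have "G s - c0 * s \<le> G t - c0 * t"
    by (intro DERIV_nonneg_imp_nondecreasing[OF assms(3)]) blast
  then show ?thesis by (simp add: algebra_simps)
qed

text \<open>Pairing survives truncation: by \<open>eps\<close> the removed ball lies in front of the
  plane, so it can contain only the near point of a pair. The hypothesis \<open>neg\<close> handles
  exactly those pairs.\<close>

lemma reflected_pair_le:
  fixes u :: "real ^ 'n::finite \<Rightarrow> real" and i :: 'n and lam \<alpha> :: real
  defines "v \<equiv> \<lambda>x. u (reflect i lam x)"
  defines "w \<equiv> \<lambda>x. v x - u x"
  defines "p \<equiv> real CARD('n) + \<alpha>"
  assumes "0 < \<alpha>" and slope: "\<And>s t. s \<le> t \<Longrightarrow> c0 * (t - s) \<le> G t - G s" and "c0 > 0"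
    and "0 < \<epsilon>" and eps: "\<epsilon> \<le> lam - x $ i"
    and neg: "\<And>z. z \<in> ball x \<epsilon> \<Longrightarrow> w z \<le> 0"
    and wmin: "w x \<le> w z" and "w x \<le> 0" and z: "z $ i \<le> lam"
  defines "f \<equiv> \<lambda>y. indicator (- ball x \<epsilon>) y * (F_integrand G \<alpha> v x y - F_integrand G \<alpha> u x y)"
  shows "f z + f (reflect i lam z) \<le> c0 * w x / norm (x - reflect i lam z) powr p"
proof -
  define z' where "z' = reflect i lam z"
  define a where "a = G (v x - v z) - G (u x - u z)"
  \<comment> \<open>At \<open>z'\<close> the roles swap: \<open>v z' = u z\<close> and
    \<open>u z' = v z\<close>.\<close>
  define b where "b = G (v x - u z) - G (u x - v z)"
  define K K' where "K = 1 / norm (x - z) powr p" and "K' = 1 / norm (x - z') powr p"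
  have "lam - x $ i \<le> \<bar>(x - z') $ i\<bar>"
    using z by (simp add: z'_def reflect_nth)
  also have "\<dots> \<le> norm (x - z')"
    by (rule component_le_norm_cart)
  finally have far: "\<epsilon> \<le> norm (x - z')"
    using eps by simp
  then have z': "z' \<notin> ball x \<epsilon>"
    by (simp add: dist_norm)
  have fz': "f z' = b * K'"
    using z' by (simp add: f_def F_integrand_def b_def K'_def p_def v_def z'_def diff_divide_distrib)
  have "0 \<le> K'"
    by (simp add: K'_def)
  have "f z + f z' \<le> c0 * w x * K'"
  proof (cases "z \<in> ball x \<epsilon>")
    \<comment> \<open>The truncation removes only one half of such a pair; \<open>w z \<le> 0\<close> controls the other half,
      at the price of \<open>c0\<close> instead of \<open>2 * c0\<close>.\<close>
    case True
    have "w z \<le> 0"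
      using neg True by blast
    have "c0 * ((u x - v z) - (v x - u z)) \<le> G (u x - v z) - G (v x - u z)"
      using \<open>w z \<le> 0\<close> \<open>w x \<le> 0\<close> by (intro slope) (simp add: w_def)
    then have "b \<le> c0 * w x + c0 * w z"
      by (simp add: b_def w_def algebra_simps)
    then have "b \<le> c0 * w x"
      using \<open>w z \<le> 0\<close> \<open>c0 > 0\<close> mult_nonneg_nonpos[of c0 "w z"] by linarith
    then have "b * K' \<le> c0 * w x * K'"
      using \<open>0 \<le> K'\<close> by (rule mult_right_mono)
    moreover have "f z = 0"
      using True by (simp add: f_def)
    ultimately show ?thesis
      by (simp add: fz')
  next
    case False
    have fz: "f z = a * K"
      using False by (simp add: f_def F_integrand_def a_def K_def p_def diff_divide_distrib)
    have "c0 * ((u x - u z) - (v x - v z)) \<le> G (u x - u z) - G (v x - v z)"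
      using wmin by (intro slope) (simp add: w_def)
    moreover have "0 \<le> c0 * ((u x - u z) - (v x - v z))"
      using wmin \<open>c0 > 0\<close> by (simp add: w_def)
    ultimately have "a \<le> 0"
      by (simp add: a_def)
    \<comment> \<open>Regroup \<open>a + b\<close> by the subtracted value, \<open>u z\<close> or
      \<open>v z\<close>. In each group the two arguments of \<open>G\<close> differ by
      \<open>w x\<close>, so each contributes at most \<open>c0 * w x\<close>.\<close>
    have "c0 * ((u x - u z) - (v x - u z)) \<le> G (u x - u z) - G (v x - u z)"
      using \<open>w x \<le> 0\<close> by (intro slope) (simp add: w_def)
    moreover have "c0 * ((u x - v z) - (v x - v z)) \<le> G (u x - v z) - G (v x - v z)"
      using \<open>w x \<le> 0\<close> by (intro slope) (simp add: w_def)
    ultimately have "a + b \<le> c0 * w x + c0 * w x"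
      by (simp add: a_def b_def w_def algebra_simps)
    \<comment> \<open>One of the two copies is given up, so that both cases share the same
      bound.\<close>
    then have ab: "a + b \<le> c0 * w x"
      using \<open>w x \<le> 0\<close> \<open>c0 > 0\<close> mult_nonneg_nonpos[of c0 "w x"] by linarith
    have "0 < norm (x - z)"
      using False \<open>0 < \<epsilon>\<close> by (auto simp: dist_norm)
    moreover have "norm (x - z) \<le> norm (x - z')"
      unfolding z'_def using eps \<open>0 < \<epsilon>\<close> z by (intro norm_diff_le_norm_diff_reflect) auto
    ultimately have "K' \<le> K"
      unfolding K_def K'_def p_def using \<open>0 < \<alpha>\<close>
      by (intro divide_left_mono powr_mono2 mult_pos_pos) auto
    have "a * K + b * K' \<le> a * K' + b * K'"
      using \<open>K' \<le> K\<close> \<open>a \<le> 0\<close> by (simp add: mult_left_mono_neg)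
    also have "\<dots> = (a + b) * K'"
      by (simp add: algebra_simps)
    also have "\<dots> \<le> c0 * w x * K'"
      using ab \<open>0 \<le> K'\<close> by (rule mult_right_mono)
    finally show ?thesis
      by (simp add: fz fz')
  qed
  then show ?thesis
    by (simp add: z'_def K'_def)
qed

section \<open>Integrated estimate and removal of the truncation\<close>

lemma F_truncated_diff_le:
  fixes u :: "real ^ 'n::finite \<Rightarrow> real" and i :: 'n and lam \<alpha> :: real
  defines "v \<equiv> \<lambda>x. u (reflect i lam x)"
  defines "w \<equiv> \<lambda>x. v x - u x"
  defines "p \<equiv> real CARD('n) + \<alpha>"
  assumes "0 < \<alpha>" and slope: "\<And>s t. s \<le> t \<Longrightarrow> c0 * (t - s) \<le> G t - G s" and "c0 > 0"
    and "0 < \<epsilon>" and eps: "\<epsilon> \<le> lam - x $ i"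
    and neg: "\<And>z. z \<in> ball x \<epsilon> \<Longrightarrow> w z \<le> 0"
    and wmin: "\<And>z. z $ i \<le> lam \<Longrightarrow> w x \<le> w z" and "w x \<le> 0"
    and int_u: "set_integrable lebesgue (- ball x \<epsilon>) (F_integrand G \<alpha> u x)"
    and int_v: "set_integrable lebesgue (- ball x \<epsilon>) (F_integrand G \<alpha> v x)"
    and "0 < r" and r: "lam - x $ i \<le> r"
  shows "F_truncated G \<alpha> v x \<epsilon> - F_truncated G \<alpha> u x \<epsilon>
    \<le> c0 * w x * (measure lebesgue (ball (0 :: real ^ 'n) 1) / 5 powr p) / r powr \<alpha>"
proof -
  define f where
    "f = (\<lambda>y. indicator (- ball x \<epsilon>) y * (F_integrand G \<alpha> v x y - F_integrand G \<alpha> u x y))"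
  \<comment> \<open>Since \<open>lam - x $ i \<le> r\<close>, a centre \<open>4 * r\<close> away
    from \<open>x\<close> puts the whole ball beyond the plane, and all its points lie within
    \<open>5 * r\<close> of \<open>x\<close>.\<close>
  define B where "B = ball (x + (4 * r) *\<^sub>R axis i 1) r"
  \<comment> \<open>The pair bound at the largest distance \<open>5 * r\<close>; as
    \<open>w x \<le> 0\<close>, this is its weakest value on \<open>B\<close>.\<close>
  define m where "m = c0 * w x / (5 * r) powr p"
  define g where "g = (\<lambda>z. m * indicator B z)"
  have "m \<le> 0"
    using \<open>w x \<le> 0\<close> \<open>c0 > 0\<close> by (simp add: m_def divide_nonpos_nonneg mult_nonneg_nonpos)
  have B_far: "lam < z $ i" and B_near: "norm (x - z) \<le> 5 * r" if "z \<in> B" for z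
  proof -
    define d where "d = x + (4 * r) *\<^sub>R axis i 1 - z"
    have d: "norm d < r"
      using that by (simp add: B_def d_def dist_norm)
    have "d $ i = x $ i + 4 * r - z $ i"
      by (simp add: d_def)
    then show "lam < z $ i"
      using component_le_norm_cart[of d i] d r \<open>0 < r\<close> by linarith
    have "x - z = d - (4 * r) *\<^sub>R axis i 1"
      by (simp add: d_def)
    then have "norm (x - z) \<le> norm d + norm ((4 * r) *\<^sub>R axis i 1 :: real ^ 'n)"
      by (metis norm_triangle_ineq4)
    also have "\<dots> \<le> 5 * r"
      using d \<open>0 < r\<close> by simp
    finally show "norm (x - z) \<le> 5 * r" .
  qed
  have half: "f z + f (reflect i lam z) \<le> g z + g (reflect i lam z)" if z: "z $ i \<le> lam" for z
  proof -
    define z' where "z' = reflect i lam z"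
    have "f z + f z' \<le> c0 * w x / norm (x - z') powr p"
      unfolding f_def p_def v_def z'_def w_def
      by (rule reflected_pair_le)
        (use assms z in \<open>simp_all add: w_def v_def\<close>)
    also have "\<dots> \<le> g z'"
    proof (cases "z' \<in> B")
      case True
      have "z' $ i \<noteq> x $ i"
        using B_far[OF True] eps \<open>0 < \<epsilon>\<close> by simp
      then have "x \<noteq> z'"
        by auto
      then have "norm (x - z') powr p \<le> (5 * r) powr p" "0 < norm (x - z') powr p"
        using B_near[OF True] \<open>0 < \<alpha>\<close> by (auto intro!: powr_mono2 simp: p_def)
      then show ?thesis
        using True \<open>w x \<le> 0\<close> \<open>c0 > 0\<close> \<open>0 < r\<close>
        by (auto simp: g_def m_def intro!: divide_left_mono_neg mult_nonneg_nonpos)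
    next
      case False
      then show ?thesis
        using \<open>w x \<le> 0\<close> \<open>c0 > 0\<close>
        by (simp add: g_def divide_nonpos_nonneg mult_nonneg_nonpos)
    qed
    \<comment> \<open>\<open>z\<close> is not beyond the plane, hence outside \<open>B\<close>, and
      \<open>g z = 0\<close>.\<close>
    also have "g z' = g z + g z'"
      using B_far[of z] z by (force simp: g_def)
    finally show ?thesis
      by (simp add: z'_def)
  qed
  have pair: "f z + f (reflect i lam z) \<le> g z + g (reflect i lam z)" for z
  proof (cases "z $ i \<le> lam")
    case False
    then have "reflect i lam z $ i \<le> lam"
      by (simp add: reflect_nth)
    from half[OF this] show ?thesis
      by (simp add: add.commute)
  qed (rule half)
  have f_eq: "f = (\<lambda>y. indicator (- ball x \<epsilon>) y *\<^sub>R F_integrand G \<alpha> v x y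
      - indicator (- ball x \<epsilon>) y *\<^sub>R F_integrand G \<alpha> u x y)"
    by (simp add: f_def fun_eq_iff right_diff_distrib)
  have f: "integrable lebesgue f"
    unfolding f_eq using int_u int_v
    by (intro Bochner_Integration.integrable_diff) (auto simp: set_integrable_def)
  have B: "B \<in> lmeasurable"
    by (simp add: B_def)
  have g: "integrable lebesgue g"
    unfolding g_def using B
    by (intro integrable_mult_right integrable_real_indicator) (auto simp: fmeasurable_def)
  \<comment> \<open>Symmetrising over the whole space replaces splitting into half-spaces: by
    invariance of the measure each pair is counted twice, on both sides of the comparison.\<close>
  have "2 * integral\<^sup>L lebesgue f = (\<integral>z. f z + f (reflect i lam z) \<partial>lebesgue)"
    by (simp add: f integrable_reflect_lebesgue integral_reflect_lebesgue)
  also have "\<dots> \<le> (\<integral>z. g z + g (reflect i lam z) \<partial>lebesgue)"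
    by (intro integral_mono Bochner_Integration.integrable_add integrable_reflect_lebesgue f g pair)
  also have "\<dots> = 2 * integral\<^sup>L lebesgue g"
    by (simp add: g integrable_reflect_lebesgue integral_reflect_lebesgue)
  finally have "integral\<^sup>L lebesgue f \<le> integral\<^sup>L lebesgue g"
    by simp
  moreover have "integral\<^sup>L lebesgue f = F_truncated G \<alpha> v x \<epsilon> - F_truncated G \<alpha> u x \<epsilon>"
    unfolding f_eq F_truncated_def set_lebesgue_integral_def
    using int_u int_v
    by (intro Bochner_Integration.integral_diff) (auto simp: set_integrable_def)
  moreover have "integral\<^sup>L lebesgue g = m * measure lebesgue B"
    by (simp add: g_def)
  moreover have "measure lebesgue B = r powr real CARD('n) * measure lebesgue (ball (0 :: real ^ 'n) 1)"
    using content_ball_conv_unit_ball[of r "x + (4 * r) *\<^sub>R axis i 1"] \<open>0 < r\<close>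
    by (simp add: B_def powr_realpow)
  \<comment> \<open>The volume of \<open>B\<close> supplies r to the power n, which cancels against
    \<open>(5 * r) powr p\<close> and leaves \<open>5 powr p * r powr \<alpha>\<close> in the
    denominator.\<close>
  ultimately show ?thesis
    using \<open>0 < r\<close> by (simp add: m_def p_def powr_mult powr_add)
qed

text \<open>The bound on the truncations is free of \<epsilon>, so it passes to the limit. For small
  \<epsilon> the ball stays in front of the plane, and \<open>w\<close> is negative on it by
  continuity at \<open>x\<close>.\<close>

lemma F_op_diff_le:
  fixes u :: "real ^ 'n::finite \<Rightarrow> real" and i :: 'n and lam \<alpha> :: real
  defines "v \<equiv> \<lambda>x. u (reflect i lam x)"
  defines "w \<equiv> \<lambda>x. v x - u x"
  defines "p \<equiv> real CARD('n) + \<alpha>"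
  assumes "0 < \<alpha>" and "C > 0"
    and slope: "\<And>s t. s \<le> t \<Longrightarrow> c0 * (t - s) \<le> G t - G s" and "c0 > 0"
    and "x $ i < lam" and "isCont w x" and "w x < 0"
    and wmin: "\<And>z. z $ i \<le> lam \<Longrightarrow> w x \<le> w z"
    and wd_u: "F_well_defined G \<alpha> u x" and wd_v: "F_well_defined G \<alpha> v x"
    and "0 < r" and r: "lam - x $ i \<le> r"
  shows "F_op C G \<alpha> v x - F_op C G \<alpha> u x
    \<le> C * (c0 * w x * (measure lebesgue (ball (0 :: real ^ 'n) 1) / 5 powr p) / r powr \<alpha>)"
proof -
  obtain lu lv where lu: "(F_truncated G \<alpha> u x \<longlongrightarrow> lu) (at_right 0)"
    and lv: "(F_truncated G \<alpha> v x \<longlongrightarrow> lv) (at_right 0)"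
    using wd_u wd_v by (auto simp: F_well_defined_def)
  obtain d where "0 < d" and "\<forall>z. dist z x < d \<longrightarrow> dist (w z) (w x) < - w x"
    using \<open>isCont w x\<close> \<open>w x < 0\<close> unfolding continuous_at_eps_delta by (meson neg_0_less_iff_less)
  then have d: "w z < 0" if "dist z x < d" for z
    using that by (force simp: dist_real_def)
  define e where "e = min d (lam - x $ i)"
  have "0 < e"
    using \<open>0 < d\<close> \<open>x $ i < lam\<close> by (simp add: e_def)
  have "lv - lu \<le> c0 * w x * (measure lebesgue (ball (0 :: real ^ 'n) 1) / 5 powr p) / r powr \<alpha>"
  proof (rule tendsto_upperbound[OF tendsto_diff[OF lv lu]])
    show "\<forall>\<^sub>F \<epsilon> in at_right 0. F_truncated G \<alpha> v x \<epsilon> - F_truncated G \<alpha> u x \<epsilon>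
        \<le> c0 * w x * (measure lebesgue (ball (0 :: real ^ 'n) 1) / 5 powr p) / r powr \<alpha>"
    proof (rule eventually_at_rightI[OF _ \<open>0 < e\<close>])
      fix \<epsilon> assume \<epsilon>: "\<epsilon> \<in> {0<..<e}"
      show "F_truncated G \<alpha> v x \<epsilon> - F_truncated G \<alpha> u x \<epsilon>
          \<le> c0 * w x * (measure lebesgue (ball (0 :: real ^ 'n) 1) / 5 powr p) / r powr \<alpha>"
        unfolding v_def w_def p_def
      proof (rule F_truncated_diff_le)
        show "u (reflect i lam z) - u z \<le> 0" if "z \<in> ball x \<epsilon>" for z
          using d[of z] that \<epsilon> by (simp add: w_def v_def e_def dist_commute)
      qed (use assms \<epsilon> in \<open>simp_all add: w_def v_def e_def F_well_defined_def\<close>)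
    qed
  qed simp
  moreover have "F_op C G \<alpha> v x - F_op C G \<alpha> u x = C * (lv - lu)"
    using tendsto_Lim[OF _ lu] tendsto_Lim[OF _ lv] by (simp add: F_op_def right_diff_distrib)
  ultimately show ?thesis
    using \<open>C > 0\<close> by (metis mult_left_mono less_imp_le times_divide_eq_right)
qed

section \<open>Choice of the radius and contradiction\<close>

theorem theorem2:
  fixes i :: "'n::finite"
    and \<alpha> C c0 lam :: real
    and G :: "real \<Rightarrow> real"
    and \<Omega> :: "(real ^ 'n) set"
    and c :: "real ^ 'n \<Rightarrow> real"
  assumes "0 < \<alpha>" and "\<alpha> < 2"
    and "C > 0"
    and "G C1_differentiable_on UNIV" and "G 0 = 0"
    and "c0 > 0" and "\<And>t. deriv G t \<ge> c0"
    and "open \<Omega>" and "\<Omega> \<subseteq> halfspace i lam" and "\<not> bounded \<Omega>"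
    and "Liminf (inf at_infinity (principal \<Omega>)) (\<lambda>x. ereal (norm x powr \<alpha> * c x)) \<ge> 0"
  shows "\<exists>R0>0. \<forall>u u_lam w.
     u_lam = (\<lambda>x. u (reflect i lam x)) \<longrightarrow>
     w = (\<lambda>x. u_lam x - u x) \<longrightarrow>
     u \<in> L_space \<alpha> \<longrightarrow>
     (\<forall>x\<in>\<Omega>. F_well_defined G \<alpha> u x \<and> F_well_defined G \<alpha> u_lam x) \<longrightarrow>
     w \<in> L_space \<alpha> \<inter> C11_loc \<Omega> \<longrightarrow>
     (\<forall>x\<in>\<Omega>. F_op C G \<alpha> u_lam x - F_op C G \<alpha> u x + c x * w x \<ge> 0) \<longrightarrow>
     (\<forall>x \<in> halfspace i lam - \<Omega>. w x \<ge> 0) \<longrightarrow>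
     (\<forall>x \<in> halfspace i lam. w (reflect i lam x) = - w x) \<longrightarrow>
     (\<forall>x0\<in>\<Omega>. (\<forall>x\<in>\<Omega>. w x0 \<le> w x) \<and> w x0 < 0 \<longrightarrow> norm x0 \<le> R0)"
proof -
  \<comment> \<open>The constant of \<open>F_op_diff_le\<close> for \<open>r = 2 * norm x\<close>,
    whence \<open>2 powr \<alpha>\<close>. This radius is admissible once
    \<open>\<bar>lam\<bar> \<le> norm x\<close>.\<close>
  define \<kappa> where "\<kappa> = C * c0 *
    (measure lebesgue (ball (0 :: real ^ 'n) 1) / 5 powr (real CARD('n) + \<alpha>)) / 2 powr \<alpha>"
  have "0 < \<kappa>"
    using \<open>C > 0\<close> \<open>c0 > 0\<close> content_ball_pos[of 1 "0 :: real ^ 'n"] by (simp add: \<kappa>_def)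
  then have "ereal (- \<kappa>) < 0"
    by simp
  with assms(11) have
    "\<forall>\<^sub>F x in inf at_infinity (principal \<Omega>). ereal (- \<kappa>) < ereal (norm x powr \<alpha> * c x)"
    unfolding le_Liminf_iff by blast
  then obtain R where R: "\<And>x. R \<le> norm x \<Longrightarrow> x \<in> \<Omega> \<Longrightarrow> - \<kappa> < norm x powr \<alpha> * c x"
    by (auto simp: eventually_inf_principal eventually_at_infinity)
  \<comment> \<open>Fixed before \<open>u\<close> and \<open>w\<close> appear, hence independent of
    them.\<close>
  define R0 where "R0 = max R (max \<bar>lam\<bar> 1)"
  show ?thesis
  proof (intro exI[of _ R0] conjI allI impI ballI)
    show "0 < R0"
      by (simp add: R0_def)
  next
    fix u v w x
    assume v: "v = (\<lambda>x. u (reflect i lam x))" and w: "w = (\<lambda>x. v x - u x)"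
      and wd: "\<forall>x\<in>\<Omega>. F_well_defined G \<alpha> u x \<and> F_well_defined G \<alpha> v x"
      and reg: "w \<in> L_space \<alpha> \<inter> C11_loc \<Omega>"
      and ineq: "\<forall>x\<in>\<Omega>. F_op C G \<alpha> v x - F_op C G \<alpha> u x + c x * w x \<ge> 0"
      and nonneg: "\<forall>x \<in> halfspace i lam - \<Omega>. w x \<ge> 0"
      and "x \<in> \<Omega>" and xmin: "(\<forall>y\<in>\<Omega>. w x \<le> w y) \<and> w x < 0"
    show "norm x \<le> R0"
    proof (rule ccontr)
      assume "\<not> norm x \<le> R0"
      then have large: "R \<le> norm x" "\<bar>lam\<bar> \<le> norm x" "0 < norm x"
        by (auto simp: R0_def)
      have "x $ i < lam"
        using \<open>x \<in> \<Omega>\<close> \<open>\<Omega> \<subseteq> halfspace i lam\<close> by (auto simp: halfspace_def)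
      have "isCont w x"
        using reg \<open>x \<in> \<Omega>\<close> by (auto simp: C11_loc_def intro: has_derivative_continuous)
      \<comment> \<open>The minimum over \<open>\<Omega>\<close> extends to the closed half-space:
        it is negative, while \<open>w\<close> is nonnegative on the rest of the open half-space and
        vanishes on the plane, which reflection fixes.\<close>
      have wmin: "w x \<le> w z" if "z $ i \<le> lam" for z
      proof (cases "z $ i = lam")
        case True
        then have "reflect i lam z = z"
          by (simp add: reflect_def vec_eq_iff)
        then show ?thesis
          using xmin by (simp add: w v)
      next
        case False
        then have "z \<in> halfspace i lam"
          using that by (simp add: halfspace_def)
        then show ?thesis
          using xmin nonneg by (cases "z \<in> \<Omega>") force+
      qed
      have r: "lam - x $ i \<le> 2 * norm x"
        using component_le_norm_cart[of x i] large(2) by linarith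
      have "F_op C G \<alpha> v x - F_op C G \<alpha> u x \<le> C * (c0 * w x *
        (measure lebesgue (ball (0 :: real ^ 'n) 1) / 5 powr (real CARD('n) + \<alpha>)) / (2 * norm x) powr \<alpha>)"
        unfolding v w
        by (rule F_op_diff_le)
          (use assms wd \<open>x \<in> \<Omega>\<close> \<open>x $ i < lam\<close> \<open>isCont w x\<close> wmin xmin r large deriv_ge_imp_diff_ge
            in \<open>auto simp: v w\<close>)
      also have "\<dots> = \<kappa> * w x / norm x powr \<alpha>"
        by (simp add: \<kappa>_def powr_mult mult_ac)
      finally have "0 \<le> \<kappa> * w x / norm x powr \<alpha> + c x * w x"
        using ineq \<open>x \<in> \<Omega>\<close> by force
      also have "\<dots> = (\<kappa> + norm x powr \<alpha> * c x) * w x / norm x powr \<alpha>"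
        using large(3) by (simp add: field_simps)
      also have "\<dots> < 0"
        using R[OF large(1) \<open>x \<in> \<Omega>\<close>] xmin large(3)
        by (intro divide_neg_pos mult_pos_neg) auto
      finally show False
        by simp
    qed
  qed
qed

end
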